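(* Let $P$, $X$, $Y$ be metric spaces, let $C\subset Y$ be a nonempty closed proper subset, and let $F:P\times X\rightrightarrows Y$ be a set-valued mapping with nonempty closed values at every point of $P\times X$, where $P\times X$ is equipped with the max distance. Let $S(p)=\{x\in X: F(p,x)\subseteq C\}$ for $p\in P$ and $\varphi_F(p,x)=\sup_{y\in F(p,x)}\mathrm{dist}(y,C)$. Let $\bar p\in P$ and $\bar x\in S(\bar p)$. Suppose that: (i) $(X,d)$ is metrically complete; (ii) the set-valued mapping $F(\bar p,\cdot):X\rightrightarrows Y$ is lower semicontinuous on $X$; (iii) the mapping $F$ is locally Lipschitz near $(\bar p,\bar x)$; (iv) $\overline{|\nabla\varphi_F(\bar p,\cdot)|}{}^{>}(\bar x)>0$. Then the solution mapping $S:P\rightrightarrows X$ is calm at $(\bar p,\bar x)$ and $$\mathrm{clm}\,S(\bar p,\bar x)\le\frac{\mathrm{Lip}\,F(\bar p,\bar x)}{\overline{|\nabla\varphi_F(\bar p,\cdot)|}{}^{>}(\bar x)}.$$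
   Context: All metrics are denoted $d$. $B(x,r)$ is the closed ball of center $x$ and radius $r$; $\mathrm{dist}(x,A)=\inf_{a\in A}d(x,a)$ ($=+\infty$ if $A=\varnothing$); $B(A,r)=\{x:\mathrm{dist}(x,A)\le r\}$. For subsets $A,B$ of a metric space, $\mathrm{exc}(A,B)=\sup_{a\in A}\mathrm{dist}(a,B)$ and $\mathrm{haus}(A,B)=\max\{\mathrm{exc}(A,B),\mathrm{exc}(B,A)\}$. A set-valued mapping $\Phi:X\rightrightarrows Y$ between metric spaces is: - lower semicontinuous (l.s.c.) at $\bar x$ if for every open $O\subseteq Y$ with $\Phi(\bar x)\cap O\neq\varnothing$ there is a neighbourhood $U$ of $\bar x$ with $\Phi(x)\cap O\ne\varnothing$ for all $x\in U$; - calm at $(\bar x,\bar y)$, where $\bar y\in\Phi(\bar x)$, if there are $\delta,\zeta,\ell>0$ such that $\Phi(x)\cap B(\bar y,\zeta)\subseteq B(\Phi(\bar x),\ell d(x,\bar x))$ for all $x\in B(\bar x,\delta)$; $\mathrm{clm}\,\Phi(\bar x,\bar y)$ is the infimum of all $\ell>0$ for which such $\delta,\zeta>0$ exist; - locally Lipschitz near $\bar x$ if there are $\delta,\ell>0$ such that $\mathrm{haus}(\Phi(x_1),\Phi(x_2))\le\ell d(x_1,x_2)$ for all $x_1,x_2\in B(\bar x,\delta)$; $\mathrm{Lip}\,\Phi(\bar x)$ is the infimum of all $\ell>0$ for which such a $\delta>0$ exists. For $F$ on $P\times X$, $\mathrm{Lip}\,F(\bar p,\bar x)$ denotes this modulus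 at $(\bar p,\bar x)$. The strong slope of $\psi:X\to\mathbb R\cup\{\pm\infty\}$ at a point $x$ with $\psi(x)\in\mathbb R$ is $|\nabla\psi|(x)=0$ if $x$ is a local minimizer of $\psi$, and $|\nabla\psi|(x)=\limsup_{z\to x}\frac{\psi(x)-\psi(z)}{d(z,x)}$ otherwise. The strict outer slope is $$\overline{|\nabla\psi|}{}^{>}(\bar x)=\lim_{\epsilon\to0^+}\inf\{|\nabla\psi|(x):x\in B(\bar x,\epsilon),\ \psi(\bar x)<\psi(x)<\psi(\bar x)+\epsilon\},$$ with $\inf\varnothing=+\infty$; a finite number divided by $+\infty$ is $0$. *)

theory Defs
  imports "HOL-Analysis.Analysis"
begin

text \<open>Distances and excesses are extended reals, so that the infimum over the empty set is
  \<open>\<infinity>\<close> (unlike \<^const>\<open>infdist\<close>, which returns \<open>0\<close>).\<close>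

definition dist_to :: "'a::metric_space \<Rightarrow> 'a set \<Rightarrow> ereal" where
  "dist_to x A = (INF a\<in>A. ereal (dist x a))"

definition enlargement :: "'a::metric_space set \<Rightarrow> real \<Rightarrow> 'a set" where
  "enlargement A r = {x. dist_to x A \<le> ereal r}"

text \<open>The supremum over the empty set is \<open>-\<infinity>\<close> here rather than \<open>0\<close>. This never matters for an
  inequality of the form \<open>haus A B \<le> r\<close> with \<open>r \<ge> 0\<close>, the only use made of \<open>haus\<close>.\<close>

definition exc :: "'a::metric_space set \<Rightarrow> 'a set \<Rightarrow> ereal" where
  "exc A B = (SUP a\<in>A. dist_to a B)"

definition haus :: "'a::metric_space set \<Rightarrow> 'a set \<Rightarrow> ereal" where
  "haus A B = max (exc A B) (exc B A)"

definition lsc_at :: "('a::topological_space \<Rightarrow> 'b::topological_space set) \<Rightarrow> 'a \<Rightarrow> bool" where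
  "lsc_at \<Phi> xbar \<longleftrightarrow>
    (\<forall>V. open V \<and> \<Phi> xbar \<inter> V \<noteq> {} \<longrightarrow> (\<forall>\<^sub>F x in nhds xbar. \<Phi> x \<inter> V \<noteq> {}))"

definition calm_with ::
  "('a::metric_space \<Rightarrow> 'b::metric_space set) \<Rightarrow> 'a \<Rightarrow> 'b \<Rightarrow> real \<Rightarrow> bool" where
  "calm_with \<Phi> xbar ybar l \<longleftrightarrow>
    (\<exists>\<delta>>0. \<exists>\<zeta>>0. \<forall>x\<in>cball xbar \<delta>.
       \<Phi> x \<inter> cball ybar \<zeta> \<subseteq> enlargement (\<Phi> xbar) (l * dist x xbar))"

definition calm :: "('a::metric_space \<Rightarrow> 'b::metric_space set) \<Rightarrow> 'a \<Rightarrow> 'b \<Rightarrow> bool" where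
  "calm \<Phi> xbar ybar \<longleftrightarrow> ybar \<in> \<Phi> xbar \<and> (\<exists>l>0. calm_with \<Phi> xbar ybar l)"

definition clm :: "('a::metric_space \<Rightarrow> 'b::metric_space set) \<Rightarrow> 'a \<Rightarrow> 'b \<Rightarrow> ereal" where
  "clm \<Phi> xbar ybar = Inf (ereal ` {l. l > 0 \<and> calm_with \<Phi> xbar ybar l})"

text \<open>The distance \<open>d\<close> on the domain is a parameter, because the metric of the type class instance
  for products is the Euclidean one, whereas here products carry the maximum distance.\<close>

definition max_dist :: "'a::metric_space \<times> 'b::metric_space \<Rightarrow> 'a \<times> 'b \<Rightarrow> real" where
  "max_dist u v = max (dist (fst u) (fst v)) (dist (snd u) (snd v))"

definition lipschitz_with ::
  "('a \<Rightarrow> 'a \<Rightarrow> real) \<Rightarrow> ('a \<Rightarrow> 'b::metric_space set) \<Rightarrow> 'a \<Rightarrow> real \<Rightarrow> bool" where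
  "lipschitz_with d \<Phi> xbar l \<longleftrightarrow>
    (\<exists>\<delta>>0. \<forall>x1 x2. d xbar x1 \<le> \<delta> \<and> d xbar x2 \<le> \<delta> \<longrightarrow>
       haus (\<Phi> x1) (\<Phi> x2) \<le> ereal (l * d x1 x2))"

definition locally_lipschitz_near ::
  "('a \<Rightarrow> 'a \<Rightarrow> real) \<Rightarrow> ('a \<Rightarrow> 'b::metric_space set) \<Rightarrow> 'a \<Rightarrow> bool" where
  "locally_lipschitz_near d \<Phi> xbar \<longleftrightarrow> (\<exists>l>0. lipschitz_with d \<Phi> xbar l)"

definition Lip :: "('a \<Rightarrow> 'a \<Rightarrow> real) \<Rightarrow> ('a \<Rightarrow> 'b::metric_space set) \<Rightarrow> 'a \<Rightarrow> ereal" where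
  "Lip d \<Phi> xbar = Inf (ereal ` {l. l > 0 \<and> lipschitz_with d \<Phi> xbar l})"

text \<open>Meaningful only at points where \<open>\<psi>\<close> is finite. A point that is not a local minimizer is not
  isolated, so the upper limit is taken along a proper filter.\<close>

definition strong_slope :: "('a::metric_space \<Rightarrow> ereal) \<Rightarrow> 'a \<Rightarrow> ereal" where
  "strong_slope \<psi> x =
    (if \<forall>\<^sub>F z in nhds x. \<psi> x \<le> \<psi> z then 0
     else Limsup (at x) (\<lambda>z. (\<psi> x - \<psi> z) / ereal (dist z x)))"

text \<open>The infimum increases as \<open>\<epsilon>\<close> decreases, so the limit always exists in the extended reals.\<close>

definition strict_outer_slope :: "('a::metric_space \<Rightarrow> ereal) \<Rightarrow> 'a \<Rightarrow> ereal" where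
  "strict_outer_slope \<psi> xbar =
    Lim (at_right (0::real))
      (\<lambda>\<epsilon>. INF x \<in> {x \<in> cball xbar \<epsilon>. \<psi> xbar < \<psi> x \<and> \<psi> x < \<psi> xbar + ereal \<epsilon>}. strong_slope \<psi> x)"

definition solution_map :: "('p \<times> 'x \<Rightarrow> 'y set) \<Rightarrow> 'y set \<Rightarrow> 'p \<Rightarrow> 'x set" where
  "solution_map F C p = {x. F (p, x) \<subseteq> C}"

definition merit :: "('p \<times> 'x \<Rightarrow> 'y::metric_space set) \<Rightarrow> 'y set \<Rightarrow> 'p \<Rightarrow> 'x \<Rightarrow> ereal" where
  "merit F C p x = (SUP y\<in>F (p, x). dist_to y C)"

end

theory Submission imports Defs begin

text \<open>If \<open>x\<close> solves the problem for \<open>p\<close>, the Lipschitz property bounds the merit function of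
  \<open>pbar\<close> at \<open>x\<close> by \<open>l * dist p pbar\<close>. Ekeland's principle with parameter \<open>\<sigma>\<close> below the strict outer
  slope moves \<open>x\<close> by at most \<open>l / \<sigma> * dist p pbar\<close> to a point \<open>u\<close> whose strong slope is at most \<open>\<sigma>\<close>.
  As \<open>u\<close> is still close to \<open>xbar\<close>, the merit function must vanish there, so \<open>u\<close> solves the problem for
  \<open>pbar\<close>.\<close>

section \<open>Ekeland's variational principle\<close>

text \<open>The relation \<open>z \<in> S w\<close> is reflexive on \<open>A\<close> and transitive,
  so the sets \<open>S (s n)\<close> are nested. Choosing each \<open>s (Suc n)\<close> nearly
  minimal in \<open>S (s n)\<close> makes them shrink to a single point, which is the required
  \<open>u\<close>.\<close>

lemma ekeland_variational_principle_on:
  fixes f :: "'a::metric_space \<Rightarrow> real"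
  assumes A: "complete A" and nonneg: "\<And>z. z \<in> A \<Longrightarrow> 0 \<le> f z"
    and lsc: "\<And>c. closed {z \<in> A. f z \<le> c}" and x: "x \<in> A" and \<sigma>: "0 < \<sigma>"
  obtains u where "u \<in> A" "f u + \<sigma> * dist u x \<le> f x"
    "\<And>z. z \<in> A \<Longrightarrow> z \<noteq> u \<Longrightarrow> f u < f z + \<sigma> * dist z u"
proof -
  define S where "S w = {z \<in> A. f z + \<sigma> * dist z w \<le> f w}" for w
  have S_self: "w \<in> S w" if "w \<in> A" for w
    using that by (simp add: S_def)
  have S_trans: "z \<in> S w" if "z \<in> S v" "v \<in> S w" for z v w
  proof -
    have "\<sigma> * dist z w \<le> \<sigma> * (dist z v + dist v w)"
      using \<sigma> by (intro mult_left_mono dist_triangle) auto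
    then show ?thesis using that by (auto simp: S_def algebra_simps)
  qed
  have bdd: "bdd_below (f ` S w)" for w
    using nonneg by (auto simp: S_def intro!: bdd_belowI[of _ 0])
  have step: "\<exists>v. v \<in> A \<and> v \<in> S w \<and> (\<forall>z\<in>S w. f v \<le> f z + (1/2)^n)" if w: "w \<in> A" for w and n :: nat
  proof -
    have "Inf (f ` S w) < Inf (f ` S w) + (1/2)^n" by simp
    then obtain v where "v \<in> S w" "f v < Inf (f ` S w) + (1/2)^n"
      using S_self[OF w] bdd by (subst (asm) cInf_less_iff) auto
    moreover have "Inf (f ` S w) \<le> f z" if "z \<in> S w" for z
      using that bdd by (auto intro: cInf_lower)
    ultimately show ?thesis
      by (fastforce simp: S_def)
  qed
  obtain s where s0: "s 0 = x" and sA: "\<And>n. s n \<in> A" and sS: "\<And>n. s (Suc n) \<in> S (s n)"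
    and smin: "\<And>n z. z \<in> S (s n) \<Longrightarrow> f (s (Suc n)) \<le> f z + (1/2)^n"
  proof -
    have "\<exists>s. \<forall>n. (s n \<in> A \<and> (n = 0 \<longrightarrow> s n = x)) \<and>
        (s (Suc n) \<in> S (s n) \<and> (\<forall>z\<in>S (s n). f (s (Suc n)) \<le> f z + (1/2)^n))"
      by (rule dependent_nat_choice) (use x step in auto)
    then show thesis using that by metis
  qed
  have sS': "s m \<in> S (s n)" if "n \<le> m" for n m
    using that by (induction rule: dec_induct) (auto intro: S_self sA S_trans sS)
  \<comment> \<open>By transitivity \<open>z\<close> also lies in \<open>S (s n)\<close>, so passing
    from \<open>s (Suc n)\<close> to \<open>z\<close> lowers \<open>f\<close> by at most
    \<open>(1/2)^n\<close>. Membership of \<open>z\<close> in \<open>S (s (Suc n))\<close> bounds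
    \<sigma> times the distance by that drop.\<close>
  have close: "\<sigma> * dist z (s (Suc n)) \<le> (1/2)^n" if "z \<in> S (s (Suc n))" for z n
    using smin[OF S_trans[OF that sS]] that by (auto simp: S_def)
  have "Cauchy s"
    unfolding Cauchy_altdef2
  proof (intro allI impI)
    fix e :: real assume "0 < e"
    then obtain n where n: "(1/2)^n < \<sigma> * e"
      using real_arch_pow_inv[of "\<sigma> * e" "1/2"] \<sigma> by auto
    have "dist (s m) (s (Suc n)) < e" if "m \<ge> Suc n" for m
    proof -
      have "\<sigma> * dist (s m) (s (Suc n)) < \<sigma> * e"
        using close[OF sS'[OF that]] n by (rule le_less_trans)
      then show ?thesis using \<sigma> by simp
    qed
    then show "\<exists>N. \<forall>m\<ge>N. dist (s m) (s N) < e" by blast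
  qed
  then obtain u where u: "u \<in> A" "s \<longlonglongrightarrow> u"
    using A sA unfolding complete_def by blast
  have uS: "u \<in> S (s n)" for n
  proof -
    \<comment> \<open>Only the distances are known to converge along \<open>s\<close>, not the
      values of \<open>f\<close>. The slack \<open>e\<close> places a tail of \<open>s\<close> in
      one fixed sublevel set, whose closedness then transfers the bound to \<open>u\<close>.\<close>
    have "f u \<le> f (s n) - \<sigma> * dist u (s n) + e" if "e > 0" for e
    proof -
      have "(\<lambda>m. f (s n) - \<sigma> * dist (s m) (s n)) \<longlonglongrightarrow> f (s n) - \<sigma> * dist u (s n)"
        by (intro tendsto_intros u)
      then have "\<forall>\<^sub>F m in sequentially.
          f (s n) - \<sigma> * dist (s m) (s n) < f (s n) - \<sigma> * dist u (s n) + e"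
        by (rule order_tendstoD) (use that in simp)
      moreover have "\<forall>\<^sub>F m in sequentially. f (s m) + \<sigma> * dist (s m) (s n) \<le> f (s n)"
        using eventually_ge_at_top[of n] by eventually_elim (use sS' in \<open>auto simp: S_def\<close>)
      ultimately have "\<forall>\<^sub>F m in sequentially.
          s m \<in> {z \<in> A. f z \<le> f (s n) - \<sigma> * dist u (s n) + e}"
        by eventually_elim (use sA in auto)
      from Lim_in_closed_set[OF lsc this _ u(2)] show ?thesis by auto
    qed
    then have "f u \<le> f (s n) - \<sigma> * dist u (s n)" by (rule field_le_epsilon)
    then show ?thesis using u by (simp add: S_def)
  qed
  show thesis
  proof
    show "u \<in> A" by fact
    show "f u + \<sigma> * dist u x \<le> f x" using uS[of 0] s0 by (simp add: S_def)
    fix z assume z: "z \<in> A" "z \<noteq> u"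
    show "f u < f z + \<sigma> * dist z u"
    proof (rule ccontr)
      assume "\<not> ?thesis"
      then have "z \<in> S u" using z by (simp add: S_def)
      then have zS: "z \<in> S (s n)" for n using uS S_trans by blast
      \<comment> \<open>Both \<open>z\<close> and \<open>u\<close> lie within
        \<open>(1/2)^n / \<sigma>\<close> of \<open>s (Suc n)\<close>; for large \<open>n\<close>
        twice this radius falls below \<open>dist z u\<close>.\<close>
      have "0 < \<sigma> * dist z u" using z \<sigma> by simp
      then obtain n where n: "(1/2)^n < \<sigma> * dist z u / 2"
        using real_arch_pow_inv[of "\<sigma> * dist z u / 2" "1/2"] by auto
      have "\<sigma> * dist z u \<le> \<sigma> * (dist z (s (Suc n)) + dist u (s (Suc n)))"
        using \<sigma> by (intro mult_left_mono dist_triangle2) auto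
      then show False
        using close[OF zS, of n] close[OF uS, of n] n by (simp add: algebra_simps)
    qed
  qed
qed

text \<open>Infinite values are removed by restricting to the sublevel set of
  \<open>\<psi> x\<close>, which is closed, hence complete. Outside it the values exceed
  \<open>\<psi> u\<close>, so the strict inequality extends to all points.\<close>

lemma ekeland_variational_principle:
  fixes \<psi> :: "'a::metric_space \<Rightarrow> ereal"
  assumes "complete (UNIV :: 'a set)" and nonneg: "\<And>z. 0 \<le> \<psi> z"
    and lsc: "\<And>c. closed {z. \<psi> z \<le> c}" and x: "\<psi> x < \<infinity>" and \<sigma>: "0 < \<sigma>"
  obtains u where "\<psi> u + ereal (\<sigma> * dist u x) \<le> \<psi> x"
    "\<And>z. z \<noteq> u \<Longrightarrow> \<psi> u < \<psi> z + ereal (\<sigma> * dist z u)"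
proof -
  define A where "A = {z. \<psi> z \<le> \<psi> x}"
  define f where "f z = real_of_ereal (\<psi> z)" for z
  have f: "\<psi> z = ereal (f z)" if "z \<in> A" for z
    using that x nonneg[of z] by (cases "\<psi> z") (auto simp: A_def f_def)
  have "complete A"
    using lsc assms(1) complete_Int_closed[of UNIV A] by (simp add: A_def)
  moreover have "0 \<le> f z" for z using nonneg by (simp add: f_def real_of_ereal_pos)
  moreover have "closed {z \<in> A. f z \<le> c}" for c
  proof -
    have "f z \<le> c \<longleftrightarrow> \<psi> z \<le> ereal c" if "z \<in> A" for z
      using f[OF that] by simp
    then have "{z \<in> A. f z \<le> c} = {z. \<psi> z \<le> \<psi> x} \<inter> {z. \<psi> z \<le> ereal c}"
      by (auto simp: A_def)
    then show ?thesis using lsc by auto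
  qed
  moreover have xA: "x \<in> A" by (simp add: A_def)
  ultimately obtain u where u: "u \<in> A" "f u + \<sigma> * dist u x \<le> f x"
    "\<And>z. z \<in> A \<Longrightarrow> z \<noteq> u \<Longrightarrow> f u < f z + \<sigma> * dist z u"
    using ekeland_variational_principle_on \<sigma> by blast
  show thesis
  proof
    show "\<psi> u + ereal (\<sigma> * dist u x) \<le> \<psi> x" using u f xA by simp
    fix z assume "z \<noteq> u"
    show "\<psi> u < \<psi> z + ereal (\<sigma> * dist z u)"
    proof (cases "z \<in> A")
      case True
      then show ?thesis using u f \<open>z \<noteq> u\<close> by simp
    next
      case False
      then have "\<psi> u < \<psi> z" using u(1) by (auto simp: A_def)
      also have "\<psi> z \<le> \<psi> z + ereal (\<sigma> * dist z u)" using \<sigma> by (simp add: add_increasing2)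
      finally show ?thesis .
    qed
  qed
qed

section \<open>Strong slope and strict outer slope\<close>

text \<open>Rearranged, the last hypothesis bounds every difference quotient at \<open>u\<close> by
  \<sigma>, hence also their upper limit. For a local minimizer, of slope 0,
  \<open>0 \<le> \<sigma>\<close> is what counts.\<close>

lemma strong_slope_le:
  assumes "\<bar>\<psi> u\<bar> \<noteq> \<infinity>" and "0 \<le> \<sigma>"
    and "\<And>z. z \<noteq> u \<Longrightarrow> \<psi> u \<le> \<psi> z + ereal (\<sigma> * dist z u)"
  shows "strong_slope \<psi> u \<le> ereal \<sigma>"
proof -
  have "(\<psi> u - \<psi> z) / ereal (dist z u) \<le> ereal \<sigma>" if "z \<noteq> u" for z
  proof (cases "\<psi> z")
    case (real b)
    moreover obtain a where "\<psi> u = ereal a" using assms(1) by (cases "\<psi> u") auto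
    ultimately show ?thesis using assms(3)[OF that] that by (simp add: divide_le_eq)
  \<comment> \<open>The value \<open>-\<infinity>\<close> of \<open>\<psi> z\<close> contradicts the
    hypothesis, and \<open>\<infinity>\<close> makes the quotient
    \<open>-\<infinity>\<close>.\<close>
  qed (use assms(1) assms(3)[OF that] that in \<open>cases "\<psi> u"; simp\<close>)+
  then have "Limsup (at u) (\<lambda>z. (\<psi> u - \<psi> z) / ereal (dist z u)) \<le> ereal \<sigma>"
    by (intro Limsup_bounded) (auto simp: eventually_at_filter)
  then show ?thesis using assms(2) by (simp add: strong_slope_def)
qed

text \<open>The infimum \<open>g \<epsilon>\<close> grows as \<epsilon> decreases, so its limit at 0
  is the supremum over positive \<epsilon>; a number below the supremum is below some
  \<open>g \<epsilon>\<close>.\<close>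

lemma less_strict_outer_slopeD:
  assumes "\<sigma> < strict_outer_slope \<psi> xbar"
  obtains \<epsilon> where "\<epsilon> > 0"
    "\<And>x. dist xbar x \<le> \<epsilon> \<Longrightarrow> \<psi> xbar < \<psi> x \<Longrightarrow> \<psi> x < \<psi> xbar + ereal \<epsilon> \<Longrightarrow> \<sigma> < strong_slope \<psi> x"
proof -
  define D where "D \<epsilon> = {x \<in> cball xbar \<epsilon>. \<psi> xbar < \<psi> x \<and> \<psi> x < \<psi> xbar + ereal \<epsilon>}" for \<epsilon>
  define g where "g \<epsilon> = (INF x \<in> D \<epsilon>. strong_slope \<psi> x)" for \<epsilon>
  have "D \<epsilon> \<subseteq> D \<epsilon>'" if "\<epsilon> \<le> \<epsilon>'" for \<epsilon> \<epsilon>'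
  proof -
    have "\<psi> xbar + ereal \<epsilon> \<le> \<psi> xbar + ereal \<epsilon>'" using that by (intro add_left_mono) simp
    then show ?thesis using that unfolding D_def by fastforce
  qed
  then have g_mono: "g \<epsilon>' \<le> g \<epsilon>" if "\<epsilon> \<le> \<epsilon>'" for \<epsilon> \<epsilon>'
    using that unfolding g_def by (intro INF_superset_mono) auto
  have "(g \<longlongrightarrow> (SUP \<epsilon>\<in>{0<..}. g \<epsilon>)) (at_right 0)"
  proof (rule order_tendstoI)
    fix a assume "a < (SUP \<epsilon>\<in>{0<..}. g \<epsilon>)"
    then obtain e where e: "e > 0" "a < g e" by (auto simp: less_SUP_iff)
    then have "\<forall>\<^sub>F \<epsilon> in at_right 0. \<epsilon> < e" by (auto simp: eventually_at_right_field)
    then show "\<forall>\<^sub>F \<epsilon> in at_right 0. a < g \<epsilon>"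
      by eventually_elim (meson e(2) g_mono less_imp_le less_le_trans)
  next
    fix a assume a: "(SUP \<epsilon>\<in>{0<..}. g \<epsilon>) < a"
    have "\<forall>\<^sub>F \<epsilon> in at_right (0::real). \<epsilon> > 0" by (rule eventually_at_right_less)
    then show "\<forall>\<^sub>F \<epsilon> in at_right 0. g \<epsilon> < a"
    proof eventually_elim
      case (elim \<epsilon>)
      then have "g \<epsilon> \<le> (SUP \<epsilon>\<in>{0<..}. g \<epsilon>)" by (intro SUP_upper) simp
      with a show ?case by simp
    qed
  qed
  then have "strict_outer_slope \<psi> xbar = (SUP \<epsilon>\<in>{0<..}. g \<epsilon>)"
    unfolding strict_outer_slope_def g_def D_def by (intro tendsto_Lim) auto
  with assms obtain \<epsilon> where \<epsilon>: "\<epsilon> > 0" "\<sigma> < g \<epsilon>" by (auto simp: less_SUP_iff)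
  show thesis
  proof (rule that[OF \<epsilon>(1)])
    fix x assume "dist xbar x \<le> \<epsilon>" "\<psi> xbar < \<psi> x" "\<psi> x < \<psi> xbar + ereal \<epsilon>"
    then have "g \<epsilon> \<le> strong_slope \<psi> x" unfolding g_def by (intro INF_lower) (simp add: D_def)
    with \<epsilon>(2) show "\<sigma> < strong_slope \<psi> x" by simp
  qed
qed

section \<open>The merit function\<close>

lemma dist_to_eq_infdist:
  assumes "A \<noteq> {}"
  shows "dist_to x A = ereal (infdist x A)"
  using assms ereal_Inf'[of "dist x ` A"] by (simp add: dist_to_def infdist_def image_image)

lemma merit_nonneg:
  assumes "C \<noteq> {}" "F (p, x) \<noteq> {}"
  shows "0 \<le> merit F C p x"
proof -
  obtain y where "y \<in> F (p, x)" using assms by auto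
  then have "dist_to y C \<le> merit F C p x" unfolding merit_def by (rule SUP_upper)
  moreover have "0 \<le> dist_to y C" using assms(1) by (simp add: dist_to_eq_infdist infdist_nonneg)
  ultimately show ?thesis by simp
qed

text \<open>A supremum of nonnegative distances over a nonempty set vanishes only if each distance
  does, and distance 0 to a closed set means membership.\<close>

lemma merit_eq_0_iff:
  assumes "C \<noteq> {}" "closed C" "F (p, x) \<noteq> {}"
  shows "merit F C p x = 0 \<longleftrightarrow> x \<in> solution_map F C p"
proof -
  have "merit F C p x = 0 \<longleftrightarrow> merit F C p x \<le> 0"
    using merit_nonneg[of C F p x] assms by auto
  also have "\<dots> \<longleftrightarrow> (\<forall>y\<in>F (p, x). infdist y C = 0)"
    using assms(1) infdist_nonneg[of _ C]
    by (auto simp: merit_def SUP_le_iff dist_to_eq_infdist intro: antisym)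
  also have "\<dots> \<longleftrightarrow> x \<in> solution_map F C p"
    using assms in_closed_iff_infdist_zero[of C] by (auto simp: solution_map_def)
  finally show ?thesis .
qed

text \<open>The merit exceeds \<open>c\<close> exactly where \<open>F (p, x)\<close> meets the open
  set \<open>V\<close>, and lower semicontinuity makes this an open condition on
  \<open>x\<close>.\<close>

lemma closed_sublevel_merit:
  assumes "C \<noteq> {}" and lsc: "\<And>x. lsc_at (\<lambda>x. F (p, x)) x"
  shows "closed {x. merit F C p x \<le> c}"
proof -
  define V where "V = {y. c < dist_to y C}"
  have "open V"
    unfolding V_def dist_to_eq_infdist[OF assms(1)]
    by (intro open_Collect_less continuous_intros)
  have iff: "c < merit F C p x \<longleftrightarrow> F (p, x) \<inter> V \<noteq> {}" for x
    by (auto simp: merit_def less_SUP_iff V_def)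
  have "open {x. c < merit F C p x}"
    unfolding iff
  proof (rule Topological_Spaces.openI)
    fix x assume "x \<in> {x. F (p, x) \<inter> V \<noteq> {}}"
    then have "\<forall>\<^sub>F x in nhds x. F (p, x) \<inter> V \<noteq> {}"
      using lsc[of x] \<open>open V\<close> by (auto simp: lsc_at_def)
    then show "\<exists>T. open T \<and> x \<in> T \<and> T \<subseteq> {x. F (p, x) \<inter> V \<noteq> {}}"
      unfolding eventually_nhds by blast
  qed
  then show ?thesis by (simp add: closed_def Collect_neg_eq[symmetric] not_le)
qed

text \<open>Replacing \<open>C\<close> by its subset \<open>F (q, x)\<close> can only increase
  distances.\<close>

lemma merit_le_exc:
  assumes "F (q, x) \<subseteq> C"
  shows "merit F C p x \<le> exc (F (p, x)) (F (q, x))"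
  unfolding merit_def exc_def dist_to_def
  using assms by (intro SUP_mono) (blast intro: INF_superset_mono)

section \<open>Calmness of the solution map\<close>

text \<open>Treats one admissible pair \<open>l\<close>, \<sigma> at a time; the bound on the
  modulus comes from optimizing the ratio \<open>l / \<sigma>\<close> over all such pairs.\<close>

lemma calm_with_solution_map:
  fixes F :: "'p::metric_space \<times> 'x::metric_space \<Rightarrow> 'y::metric_space set"
  assumes C: "C \<noteq> {}" "closed C" and ne: "\<And>p x. F (p, x) \<noteq> {}"
    and xbar: "xbar \<in> solution_map F C pbar"
    and complete: "complete (UNIV :: 'x set)"
    and lsc: "\<And>x. lsc_at (\<lambda>x. F (pbar, x)) x"
    and lip: "lipschitz_with max_dist F (pbar, xbar) l" and l: "0 < l"
    and slope: "ereal \<sigma> < strict_outer_slope (merit F C pbar) xbar" and \<sigma>: "0 < \<sigma>"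
  shows "calm_with (solution_map F C) pbar xbar (l / \<sigma>)"
proof -
  define \<psi> where "\<psi> = merit F C pbar"
  have \<psi>0: "\<psi> x = 0 \<longleftrightarrow> x \<in> solution_map F C pbar" for x
    unfolding \<psi>_def by (intro merit_eq_0_iff C ne)
  have nonneg: "0 \<le> \<psi> x" for x
    unfolding \<psi>_def by (intro merit_nonneg C ne)
  obtain \<epsilon> where \<epsilon>: "\<epsilon> > 0"
    "\<And>x. dist xbar x \<le> \<epsilon> \<Longrightarrow> 0 < \<psi> x \<Longrightarrow> \<psi> x < ereal \<epsilon> \<Longrightarrow> ereal \<sigma> < strong_slope \<psi> x"
  proof (rule less_strict_outer_slopeD[OF slope])
    fix \<epsilon> :: real
    assume "\<epsilon> > 0" "\<And>x. dist xbar x \<le> \<epsilon> \<Longrightarrow> merit F C pbar xbar < merit F C pbar x \<Longrightarrow>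
      merit F C pbar x < merit F C pbar xbar + ereal \<epsilon> \<Longrightarrow> ereal \<sigma> < strong_slope (merit F C pbar) x"
    moreover have "merit F C pbar xbar = 0" using \<psi>0[of xbar] xbar by (simp add: \<psi>_def)
    ultimately show thesis by (intro that[of \<epsilon>]) (simp_all add: \<psi>_def)
  qed
  obtain \<delta>0 where \<delta>0: "\<delta>0 > 0"
    "\<And>x1 x2. max_dist (pbar, xbar) x1 \<le> \<delta>0 \<Longrightarrow> max_dist (pbar, xbar) x2 \<le> \<delta>0 \<Longrightarrow>
       haus (F x1) (F x2) \<le> ereal (l * max_dist x1 x2)"
    using lip unfolding lipschitz_with_def by blast
  \<comment> \<open>The bound \<open>\<delta>0\<close> allows the Lipschitz estimate. The second
    term of \<delta> limits the Ekeland displacement to \<open>\<epsilon> / 2\<close>, the third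
    keeps the merit below \<epsilon>, and \<open>\<epsilon> / 2\<close> in \<zeta> leaves room for
    that displacement.\<close>
  define \<delta> where "\<delta> = min \<delta>0 (min (\<sigma> * \<epsilon> / (2 * l)) (\<epsilon> / (2 * l)))"
  define \<zeta> where "\<zeta> = min \<delta>0 (\<epsilon> / 2)"
  have pos: "\<delta> > 0" "\<zeta> > 0" using \<epsilon> \<delta>0 \<sigma> l by (auto simp: \<delta>_def \<zeta>_def)
  have "x \<in> enlargement (solution_map F C pbar) (l / \<sigma> * dist p pbar)"
    if p: "p \<in> cball pbar \<delta>" and x: "x \<in> solution_map F C p" "x \<in> cball xbar \<zeta>" for p x
  proof -
    have "dist p pbar \<le> \<sigma> * \<epsilon> / (2 * l)" "dist p pbar \<le> \<epsilon> / (2 * l)"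
      using p by (auto simp: \<delta>_def dist_commute)
    then have small: "l * dist p pbar \<le> \<sigma> * (\<epsilon> / 2)" "l * dist p pbar < \<epsilon>"
      using l \<epsilon>(1) by (auto simp: field_simps)
    have "\<psi> x \<le> haus (F (pbar, x)) (F (p, x))"
      unfolding \<psi>_def haus_def using x
      by (intro max.coboundedI1 merit_le_exc) (auto simp: solution_map_def)
    also have "\<dots> \<le> ereal (l * max_dist (pbar, x) (p, x))"
      using p x \<delta>0(1) by (intro \<delta>0(2)) (auto simp: max_dist_def \<delta>_def \<zeta>_def)
    finally have \<psi>x: "\<psi> x \<le> ereal (l * dist p pbar)"
      by (simp add: max_dist_def dist_commute)
    then have "\<psi> x < \<infinity>" by auto
    then obtain u where u: "\<psi> u + ereal (\<sigma> * dist u x) \<le> \<psi> x"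
      "\<And>z. z \<noteq> u \<Longrightarrow> \<psi> u < \<psi> z + ereal (\<sigma> * dist z u)"
      using ekeland_variational_principle[of \<psi> x \<sigma>] complete nonneg \<sigma>
        closed_sublevel_merit[OF C(1) lsc, folded \<psi>_def] by blast
    from u(1) \<psi>x have bound: "\<psi> u + ereal (\<sigma> * dist u x) \<le> ereal (l * dist p pbar)"
      by (rule order_trans)
    then obtain r where r: "\<psi> u = ereal r" "0 \<le> r"
      using nonneg[of u] by (cases "\<psi> u") auto
    with bound have r_le: "r + \<sigma> * dist u x \<le> l * dist p pbar" by simp
    have "\<sigma> * dist u x \<le> \<sigma> * (\<epsilon> / 2)" using r_le small r by linarith
    then have "dist u x \<le> \<epsilon> / 2" using \<sigma> by (simp only: mult_le_cancel_left_pos)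
    then have "dist xbar u \<le> \<epsilon>"
      using x(2) dist_triangle[of xbar u x] by (simp add: \<zeta>_def dist_commute)
    moreover have "0 \<le> \<sigma> * dist u x" using \<sigma> by simp
    then have "r < \<epsilon>" using r_le small by linarith
    moreover have "strong_slope \<psi> u \<le> ereal \<sigma>"
      using u(2) r \<sigma> by (intro strong_slope_le) (auto intro: less_imp_le)
    \<comment> \<open>Otherwise \<open>u\<close>, being within \<epsilon> of \<open>xbar\<close> and
      of merit below \<epsilon>, would have slope above \<sigma>.\<close>
    ultimately have "\<psi> u = 0"
      using \<epsilon>(2)[of u] r by (force simp: not_less)
    then have "u \<in> solution_map F C pbar" by (simp add: \<psi>0)
    then have "dist_to x (solution_map F C pbar) \<le> ereal (dist x u)"
      unfolding dist_to_def by (rule INF_lower)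
    also have "dist x u \<le> l / \<sigma> * dist p pbar"
      using r_le r \<sigma> by (simp add: field_simps dist_commute)
    finally show ?thesis by (simp add: enlargement_def)
  qed
  then show ?thesis
    unfolding calm_with_def using pos by blast
qed

theorem theorem3p3:
  fixes F :: "'p::metric_space \<times> 'x::metric_space \<Rightarrow> 'y::metric_space set"
    and C :: "'y set" and pbar :: 'p and xbar :: 'x
  assumes "C \<noteq> {}" and "closed C" and "C \<noteq> UNIV"
    and "\<And>p x. F (p, x) \<noteq> {}" and "\<And>p x. closed (F (p, x))"
    and "xbar \<in> solution_map F C pbar"
    and "complete (UNIV :: 'x set)"
    and "\<And>x. lsc_at (\<lambda>x. F (pbar, x)) x"
    and "locally_lipschitz_near max_dist F (pbar, xbar)"
    and "strict_outer_slope (merit F C pbar) xbar > 0"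
  shows "calm (solution_map F C) pbar xbar \<and>
    clm (solution_map F C) pbar xbar
      \<le> Lip max_dist F (pbar, xbar) / strict_outer_slope (merit F C pbar) xbar"
proof -
  define s where "s = strict_outer_slope (merit F C pbar) xbar"
  define L where "L = Lip max_dist F (pbar, xbar)"
  define c where "c = clm (solution_map F C) pbar xbar"
  have s_pos: "0 < s" using assms by (simp add: s_def)
  have calm_with: "calm_with (solution_map F C) pbar xbar (l / \<sigma>)"
    if "0 < l" "lipschitz_with max_dist F (pbar, xbar) l" "0 < \<sigma>" "ereal \<sigma> < s" for l \<sigma>
    by (rule calm_with_solution_map) (use assms that in \<open>auto simp: s_def\<close>)
  have c_le: "c \<le> ereal (l / \<sigma>)"
    if "0 < l" "lipschitz_with max_dist F (pbar, xbar) l" "0 < \<sigma>" "ereal \<sigma> < s" for l \<sigma>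
    unfolding c_def clm_def
    by (rule Inf_lower) (use calm_with[OF that] that in auto)
  obtain l0 where l0: "0 < l0" "lipschitz_with max_dist F (pbar, xbar) l0"
    using assms by (auto simp: locally_lipschitz_near_def)
  obtain \<sigma>0 where \<sigma>0: "0 < \<sigma>0" "ereal \<sigma>0 < s"
    using ereal_dense2[OF s_pos] by auto
  have "calm (solution_map F C) pbar xbar"
    using assms(6) calm_with[OF l0 \<sigma>0] l0 \<sigma>0 by (auto simp: calm_def intro!: exI[of _ "l0 / \<sigma>0"])
  moreover have "c \<le> L / s"
  proof -
    have "0 \<le> c" unfolding c_def clm_def by (auto intro!: Inf_greatest)
    then obtain k where k: "c = ereal k" using c_le[OF l0 \<sigma>0] by (cases c) auto
    \<comment> \<open>In product form the infimum over \<open>l\<close> can be taken with \<sigma>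
      fixed, before \<sigma> tends to \<open>s\<close>.\<close>
    have "k * \<sigma> \<le> l"
      if "0 < l" "lipschitz_with max_dist F (pbar, xbar) l" "0 < \<sigma>" "ereal \<sigma> < s" for l \<sigma>
      using c_le[OF that] that k by (simp add: field_simps)
    then have "ereal (k * \<sigma>) \<le> L" if "0 < \<sigma>" "ereal \<sigma> < s" for \<sigma>
      unfolding L_def Lip_def using that by (intro Inf_greatest) auto
    moreover have "L \<le> ereal l0" unfolding L_def Lip_def using l0 by (auto intro!: Inf_lower)
    moreover have "0 \<le> L" unfolding L_def Lip_def by (auto intro!: Inf_greatest)
    ultimately obtain L' where L': "L = ereal L'" "0 \<le> L'"
        and kL: "\<And>\<sigma>. 0 < \<sigma> \<Longrightarrow> ereal \<sigma> < s \<Longrightarrow> k * \<sigma> \<le> L'"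
      by (cases L) auto
    show ?thesis
    proof (cases s)
      case (real s')
      \<comment> \<open>Only \<sigma> strictly below \<open>s'\<close> are admissible, so
        \<open>s'\<close> is reached as a limit from the left.\<close>
      have "k * s' \<le> L'"
      proof (rule tendsto_upperbound)
        show "((\<lambda>\<sigma>. k * \<sigma>) \<longlongrightarrow> k * s') (at_left s')" by (intro tendsto_intros)
        show "\<forall>\<^sub>F \<sigma> in at_left s'. k * \<sigma> \<le> L'"
          using eventually_at_left_real[of 0 s'] s_pos real
          by (auto elim!: eventually_mono intro: kL)
      qed simp
      then show ?thesis using real s_pos k L' by (simp add: field_simps)
    next
      case PInf
      have "k \<le> 0"
      proof (rule ccontr)
        assume "\<not> k \<le> 0"
        \<comment> \<open>For this \<sigma> the product \<open>k * \<sigma>\<close> equals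
          \<open>L' + 1\<close>, above the bound \<open>L'\<close>. Thus \<open>k \<le> 0\<close>,
          in accordance with \<open>L / \<infinity> = 0\<close>.\<close>
        then show False using kL[of "(L' + 1) / k"] L' PInf by (simp add: field_simps)
      qed
      then show ?thesis using PInf k L' by simp
    qed (use s_pos in auto)
  qed
  ultimately show ?thesis by (simp add: c_def L_def s_def)
qed

end
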